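(* Let $n\ge0$ be an integer and let $f$ be a continuous function on $[a,b]$. The anti-Gauss Lagrange interpolant of $f$ admits the orthogonal expansion $$\tilde L_{n+1}(f,x)=\sum_{j=0}^{n}\hat c_j\,\phi_j(x),\qquad \hat c_j:=\sum_{k=1}^{n+1}\tilde\lambda_k f(\tilde x_k)\phi_j(\tilde x_k),\quad j=0,\dots,n,$$ and the coefficients satisfy, in vector form, $$[\hat c_0,\dots,\hat c_n]^T=Q^T\tilde\Lambda^{1/2}\mathbf f,$$ where $\tilde\Lambda=\operatorname{diag}(\tilde\lambda_1,\dots,\tilde\lambda_{n+1})$, $\mathbf f=[f(\tilde x_1),\dots,f(\tilde x_{n+1})]^T$, and $Q$ is the square matrix of order $n+1$ with entries $Q_{k,j}=\sqrt{\tilde\lambda_k}\,\phi_j(\tilde x_k)$, $k=1,\dots,n+1$, $j=0,\dots,n$.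
   Context: Let $w$ be a weight function on an interval $[a,b]$ (nonnegative, with positive integral and finite moments of all orders), and let $\langle f,g\rangle_w=\int_a^b f(x)g(x)w(x)\,dx$. Let $\{p_n\}_{n\ge0}$ be the sequence of monic orthogonal polynomials with respect to $w$ ($\deg p_n=n$, $\langle p_n,p_m\rangle_w=0$ for $n\ne m$), and set $c_n=\langle p_n,p_n\rangle_w>0$. Let $p_n(w,x)=p_n(x)/\sqrt{c_n}$ denote the orthonormal polynomials with positive leading coefficient. For $n\ge0$ the anti-Gauss polynomial of degree $n+1$ is $$\tilde p_{n+1}(x)=2p_{n+1}(x)+(a_n-x)p_n(x),\qquad a_n=\frac{\langle xp_n,p_n\rangle_w}{\langle p_n,p_n\rangle_w}.$$ It is known that its zeros $\tilde x_1,\dots,\tilde x_{n+1}$ are real, distinct and interlace the zeros of $p_n$ (so $p_n(\tilde x_k)\ne0$ and $\tilde p_{n+1}'(\tilde x_k)\ne0$); it is assumed that $w$ is such that they belong to $[a,b]$. The Christoffel numbers of the anti-Gauss formula are $$\tilde\lambda_k=\frac{2c_n}{p_n(\tilde x_k)\,\tilde p_{n+1}'(\tilde x_k)},\qquad k=1,\dots,n+1,$$ and they are positive. The modified orthonormal family is $\phi_j(x)=p_j(w,x)$ for $j=0,\dots,n-1$ and $\phi_n(x)=\frac{1}{\sqrt2}\,p_n(w,x)$. The anti-Gauss Lagrange polynomial (interpolant) of $f$ is $$\tilde L_{n+1}(f,x)=\sum_{k=1}^{n+1}\tilde\ell_k(x)f(\tilde x_k),\qquad \tilde\ell_k(x)=\prod_{j=1,\,j\ne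 k}^{n+1}\frac{x-\tilde x_j}{\tilde x_k-\tilde x_j}.$$ *)

theory Defs
  imports "HOL-Analysis.Analysis" "HOL-Computational_Algebra.Polynomial"
    "Jordan_Normal_Form.Matrix"
begin

definition weight_on :: "real \<Rightarrow> real \<Rightarrow> (real \<Rightarrow> real) \<Rightarrow> bool" where
  "weight_on a b w \<longleftrightarrow>
     (\<forall>x\<in>{a..b}. 0 \<le> w x) \<and>
     (\<forall>m::nat. set_integrable lebesgue {a..b} (\<lambda>x. x ^ m * w x)) \<and>
     0 < (LINT x:{a..b}|lebesgue. w x)"

definition w_inner :: "real \<Rightarrow> real \<Rightarrow> (real \<Rightarrow> real) \<Rightarrow> (real \<Rightarrow> real) \<Rightarrow> (real \<Rightarrow> real) \<Rightarrow> real" where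
  "w_inner a b w f g = (LINT x:{a..b}|lebesgue. f x * g x * w x)"

definition monic_orthogonal_polys :: "real \<Rightarrow> real \<Rightarrow> (real \<Rightarrow> real) \<Rightarrow> (nat \<Rightarrow> real poly) \<Rightarrow> bool" where
  "monic_orthogonal_polys a b w p \<longleftrightarrow>
     (\<forall>n. degree (p n) = n \<and> lead_coeff (p n) = 1) \<and>
     (\<forall>m n. m \<noteq> n \<longrightarrow> w_inner a b w (poly (p m)) (poly (p n)) = 0)"

definition sq_norm :: "real \<Rightarrow> real \<Rightarrow> (real \<Rightarrow> real) \<Rightarrow> (nat \<Rightarrow> real poly) \<Rightarrow> nat \<Rightarrow> real" where
  "sq_norm a b w p n = w_inner a b w (poly (p n)) (poly (p n))"

definition orthonormal_poly :: "real \<Rightarrow> real \<Rightarrow> (real \<Rightarrow> real) \<Rightarrow> (nat \<Rightarrow> real poly) \<Rightarrow> nat \<Rightarrow> real \<Rightarrow> real" where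
  "orthonormal_poly a b w p n x = poly (p n) x / sqrt (sq_norm a b w p n)"

definition recurrence_coeff :: "real \<Rightarrow> real \<Rightarrow> (real \<Rightarrow> real) \<Rightarrow> (nat \<Rightarrow> real poly) \<Rightarrow> nat \<Rightarrow> real" where
  "recurrence_coeff a b w p n =
     w_inner a b w (\<lambda>x. x * poly (p n) x) (poly (p n)) / w_inner a b w (poly (p n)) (poly (p n))"

text \<open>\<open>anti_gauss_poly a b w p n\<close> is the anti-Gauss polynomial of degree \<open>n + 1\<close>; in all
  definitions below the parameter \<open>n\<close> likewise belongs to the rule with \<open>n + 1\<close> nodes.
  The polynomial \<open>[:c, -1:]\<close> is \<open>c - x\<close>.\<close>

definition anti_gauss_poly :: "real \<Rightarrow> real \<Rightarrow> (real \<Rightarrow> real) \<Rightarrow> (nat \<Rightarrow> real poly) \<Rightarrow> nat \<Rightarrow> real poly" where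
  "anti_gauss_poly a b w p n =
     Polynomial.smult 2 (p (n + 1)) + [:recurrence_coeff a b w p n, -1:] * p n"

text \<open>\<open>xt\<close> lists the zeros as \<open>xt 1, \<dots>, xt (n + 1)\<close>; values of \<open>xt\<close> at other indices are
  irrelevant. Distinctness is not demanded here: since the anti-Gauss polynomial has \<open>n + 1\<close>
  distinct real zeros, it follows from the equation by counting.\<close>

definition enumerates_anti_gauss_zeros ::
    "real \<Rightarrow> real \<Rightarrow> (real \<Rightarrow> real) \<Rightarrow> (nat \<Rightarrow> real poly) \<Rightarrow> nat \<Rightarrow> (nat \<Rightarrow> real) \<Rightarrow> bool" where
  "enumerates_anti_gauss_zeros a b w p n xt \<longleftrightarrow>
     xt ` {1..n+1} = {x. poly (anti_gauss_poly a b w p n) x = 0}"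

definition anti_gauss_christoffel ::
    "real \<Rightarrow> real \<Rightarrow> (real \<Rightarrow> real) \<Rightarrow> (nat \<Rightarrow> real poly) \<Rightarrow> nat \<Rightarrow> (nat \<Rightarrow> real) \<Rightarrow> nat \<Rightarrow> real" where
  "anti_gauss_christoffel a b w p n xt k =
     2 * sq_norm a b w p n /
       (poly (p n) (xt k) * poly (pderiv (anti_gauss_poly a b w p n)) (xt k))"

text \<open>Meant for \<open>j \<le> n\<close>.\<close>

definition modified_orthonormal ::
    "real \<Rightarrow> real \<Rightarrow> (real \<Rightarrow> real) \<Rightarrow> (nat \<Rightarrow> real poly) \<Rightarrow> nat \<Rightarrow> nat \<Rightarrow> real \<Rightarrow> real" where
  "modified_orthonormal a b w p n j x =
     (if j < n then orthonormal_poly a b w p j x else 1 / sqrt 2 * orthonormal_poly a b w p n x)"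

definition lagrange_basis :: "nat \<Rightarrow> (nat \<Rightarrow> real) \<Rightarrow> nat \<Rightarrow> real \<Rightarrow> real" where
  "lagrange_basis n xt k x = (\<Prod>j\<in>{1..n+1} - {k}. (x - xt j) / (xt k - xt j))"

definition anti_gauss_lagrange :: "nat \<Rightarrow> (nat \<Rightarrow> real) \<Rightarrow> (real \<Rightarrow> real) \<Rightarrow> real \<Rightarrow> real" where
  "anti_gauss_lagrange n xt f x = (\<Sum>k=1..n+1. lagrange_basis n xt k x * f (xt k))"

definition expansion_coeff ::
    "real \<Rightarrow> real \<Rightarrow> (real \<Rightarrow> real) \<Rightarrow> (nat \<Rightarrow> real poly) \<Rightarrow> nat \<Rightarrow> (nat \<Rightarrow> real) \<Rightarrow> (real \<Rightarrow> real) \<Rightarrow> nat \<Rightarrow> real" where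
  "expansion_coeff a b w p n xt f j =
     (\<Sum>k=1..n+1. anti_gauss_christoffel a b w p n xt k * f (xt k) *
        modified_orthonormal a b w p n j (xt k))"

text \<open>Matrices and vectors are indexed from \<open>0\<close>, so index \<open>i\<close> belongs to the node \<open>xt (i + 1)\<close>.\<close>

definition christoffel_matrix ::
    "real \<Rightarrow> real \<Rightarrow> (real \<Rightarrow> real) \<Rightarrow> (nat \<Rightarrow> real poly) \<Rightarrow> nat \<Rightarrow> (nat \<Rightarrow> real) \<Rightarrow> real mat" where
  "christoffel_matrix a b w p n xt =
     mat_diag (n + 1) (\<lambda>i. anti_gauss_christoffel a b w p n xt (i + 1))"

text \<open>For a diagonal matrix with nonnegative entries, \<open>map_mat sqrt\<close> is the matrix square root.\<close>

definition christoffel_matrix_sqrt ::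
    "real \<Rightarrow> real \<Rightarrow> (real \<Rightarrow> real) \<Rightarrow> (nat \<Rightarrow> real poly) \<Rightarrow> nat \<Rightarrow> (nat \<Rightarrow> real) \<Rightarrow> real mat" where
  "christoffel_matrix_sqrt a b w p n xt = map_mat sqrt (christoffel_matrix a b w p n xt)"

definition Q_matrix ::
    "real \<Rightarrow> real \<Rightarrow> (real \<Rightarrow> real) \<Rightarrow> (nat \<Rightarrow> real poly) \<Rightarrow> nat \<Rightarrow> (nat \<Rightarrow> real) \<Rightarrow> real mat" where
  "Q_matrix a b w p n xt =
     Matrix.mat (n + 1) (n + 1) (\<lambda>(i, j).
       sqrt (anti_gauss_christoffel a b w p n xt (i + 1)) *
         modified_orthonormal a b w p n j (xt (i + 1)))"

definition sample_vec :: "nat \<Rightarrow> (nat \<Rightarrow> real) \<Rightarrow> (real \<Rightarrow> real) \<Rightarrow> real Matrix.vec" where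
  "sample_vec n xt f = Matrix.vec (n + 1) (\<lambda>i. f (xt (i + 1)))"

end

theory Submission
  imports Defs "Jordan_Normal_Form.Char_Poly"
begin

text \<open>
  The expansion is the statement that the fundamental Lagrange polynomials of the nodes are slices
  of a reproducing kernel. Put
  \<open>K(x,y) = \<Sum>\<^sub>j\<^sub>\<le>\<^sub>n \<phi>\<^sub>j(x) \<phi>\<^sub>j(y)\<close>. By the three-term recurrence, the anti-Gauss polynomial
  equals \<open>p\<^sub>n\<^sub>+\<^sub>1 - b\<^sub>n p\<^sub>n\<^sub>-\<^sub>1\<close> with \<open>b\<^sub>n = c\<^sub>n / c\<^sub>n\<^sub>-\<^sub>1\<close> and \<open>b\<^sub>0 = 0\<close>, and halving the last term of the Christoffel-Darboux sum
  produces precisely this combination: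
  \<open>2 c\<^sub>n (x - y) K(x,y) = A(x) p\<^sub>n(y) - A(y) p\<^sub>n(x)\<close>, where \<open>A\<close> is the anti-Gauss polynomial
  (\<open>anti_gauss_christoffel_darboux\<close>). Everything is read off from this identity and from
  \<open>K(y,y) > 0\<close>.

  First, it gives the structure of the zeros. For a complex zero \<open>z\<close> of \<open>A\<close>, taking \<open>x = z\<close> and
  \<open>y\<close> its conjugate makes the right-hand side vanish, whereas the sum becomes a positive
  combination of \<open>|p\<^sub>j(z)|\<^sup>2\<close>; hence \<open>z\<close> is real (\<open>anti_gauss_complex_root_real\<close>). For a real zero
  \<open>y\<close>, differentiating at \<open>x = y\<close> gives \<open>K(y,y) = p\<^sub>n(y) A'(y) / (2 c\<^sub>n)\<close> (\<open>kernel_diag\<close>).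
  So the zeros are simple, there are exactly \<open>n + 1\<close> of them (\<open>card_anti_gauss_roots\<close>), and the
  Christoffel number of the node \<open>y\<close> is \<open>1 / K(y,y)\<close>, in particular positive. This positivity is
  what makes the square roots in the matrix form meaningful.

  Second, for a node \<open>y\<close> the polynomial \<open>K(\<cdot>,y)\<close> is a multiple of \<open>A(x) / (x - y)\<close>, hence of the
  fundamental Lagrange polynomial of \<open>y\<close>, which therefore is \<open>K(x,y) / K(y,y)\<close>
  (\<open>lagrange_basis_eq_kernel\<close>). Summing over the nodes and exchanging the two sums gives the
  expansion.
\<close>

section \<open>The Christoffel-Darboux identity\<close>

text \<open>The identity depends only on the recurrence, so it is stated for two solutions of it in an
  arbitrary field: it is needed for values of the polynomials at complex as well as at real
  points.\<close>

lemma christoffel_darboux: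
  fixes u v h al :: "nat \<Rightarrow> 'a::field"
  assumes h: "\<And>k. h k \<noteq> 0"
    and u: "\<And>k. x * u k = u (Suc k) + al k * u k + (if k = 0 then 0 else h k / h (k - 1)) * u (k - 1)"
    and v: "\<And>k. y * v k = v (Suc k) + al k * v k + (if k = 0 then 0 else h k / h (k - 1)) * v (k - 1)"
  shows "(x - y) * (\<Sum>k\<le>n. u k * v k / h k) = (u (Suc n) * v n - u n * v (Suc n)) / h n"
proof (induction n)
  case 0
  have "(x - y) * (u 0 * v 0) = (x * u 0) * v 0 - u 0 * (y * v 0)"
    by (simp add: algebra_simps)
  also have "\<dots> = u (Suc 0) * v 0 - u 0 * v (Suc 0)"
    by (subst u, subst v) (simp add: algebra_simps)
  finally show ?case
    by simp
next
  case (Suc n)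
  have "(x - y) * (u (Suc n) * v (Suc n)) = (x * u (Suc n)) * v (Suc n) - u (Suc n) * (y * v (Suc n))"
    by (simp add: algebra_simps)
  also have "\<dots> = (u (Suc (Suc n)) * v (Suc n) - u (Suc n) * v (Suc (Suc n)))
      - h (Suc n) / h n * (u (Suc n) * v n - u n * v (Suc n))"
    by (subst u, subst v) (simp add: algebra_simps)
  finally have "(x - y) * (u (Suc n) * v (Suc n)) / h (Suc n) =
      (u (Suc (Suc n)) * v (Suc n) - u (Suc n) * v (Suc (Suc n))) / h (Suc n)
      - (u (Suc n) * v n - u n * v (Suc n)) / h n"
    using h[of n] h[of "Suc n"] by (simp add: diff_divide_distrib)
  with Suc.IH show ?case
    by (simp add: distrib_left)
qed

text \<open>If \<open>h k\<close> is the squared norm of the monic polynomial \<open>p k\<close>, this is the number whose square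
  root turns \<open>p k\<close> into the \<open>k\<close>-th member of the modified orthonormal family.\<close>

definition modified_sqnorm :: "(nat \<Rightarrow> 'a::semiring_1) \<Rightarrow> nat \<Rightarrow> nat \<Rightarrow> 'a" where
  "modified_sqnorm h n k = (if k < n then h k else 2 * h k)"

text \<open>Halving the last term of the sum replaces the Christoffel-Darboux numerators for \<open>n\<close> by the
  average of those for \<open>n\<close> and \<open>n - 1\<close>. This average is a multiple of the antisymmetrisation of
  \<open>u\<^sub>n\<^sub>+\<^sub>1 - b\<^sub>n u\<^sub>n\<^sub>-\<^sub>1 = 2 u\<^sub>n\<^sub>+\<^sub>1 + (a\<^sub>n - x) u\<^sub>n\<close> against \<open>v\<^sub>n\<close>.\<close>

lemma anti_gauss_christoffel_darboux:
  fixes u v h al :: "nat \<Rightarrow> 'a::field_char_0"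
  assumes h: "\<And>k. h k \<noteq> 0"
    and u: "\<And>k. x * u k = u (Suc k) + al k * u k + (if k = 0 then 0 else h k / h (k - 1)) * u (k - 1)"
    and v: "\<And>k. y * v k = v (Suc k) + al k * v k + (if k = 0 then 0 else h k / h (k - 1)) * v (k - 1)"
  shows "(x - y) * (\<Sum>k\<le>n. u k * v k / modified_sqnorm h n k) =
    ((2 * u (Suc n) + (al n - x) * u n) * v n - (2 * v (Suc n) + (al n - y) * v n) * u n) / (2 * h n)"
proof -
  have "(\<Sum>k\<le>n. u k * v k / h k) = (\<Sum>k<n. u k * v k / h k) + u n * v n / h n"
    by (simp flip: lessThan_Suc_atMost)
  moreover have "(\<Sum>k\<le>n. u k * v k / modified_sqnorm h n k)
      = (\<Sum>k<n. u k * v k / h k) + u n * v n / (2 * h n)"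
    by (simp add: modified_sqnorm_def flip: lessThan_Suc_atMost)
  moreover have "u n * v n / h n = 2 * (u n * v n / (2 * h n))"
    by simp
  ultimately have "(\<Sum>k\<le>n. u k * v k / modified_sqnorm h n k)
      = (\<Sum>k\<le>n. u k * v k / h k) - u n * v n / (2 * h n)"
    by (simp only: mult_2 add_diff_cancel add.assoc[symmetric])
  hence "(x - y) * (\<Sum>k\<le>n. u k * v k / modified_sqnorm h n k)
      = (x - y) * (\<Sum>k\<le>n. u k * v k / h k) - (x - y) * (u n * v n) / (2 * h n)"
    by (simp add: right_diff_distrib)
  also have "(x - y) * (\<Sum>k\<le>n. u k * v k / h k) = (u (Suc n) * v n - u n * v (Suc n)) / h n"
    by (rule christoffel_darboux[OF h u v])
  also have "\<dots> - (x - y) * (u n * v n) / (2 * h n) =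
     ((2 * u (Suc n) + (al n - x) * u n) * v n - (2 * v (Suc n) + (al n - y) * v n) * u n) / (2 * h n)"
    using h[of n] by (simp add: field_simps)
  finally show ?thesis .
qed

section \<open>Monic orthogonal polynomials of a positive functional\<close>

text \<open>The weight enters only through the linear functional \<open>q \<mapsto> \<integral> q w\<close>, and its positivity only
  through the squared norms of the \<open>p k\<close>.\<close>

locale orthogonal_polys =
  fixes L :: "real poly \<Rightarrow> real" and p :: "nat \<Rightarrow> real poly"
  assumes L_add: "L (q + r) = L q + L r"
    and L_smult: "L (Polynomial.smult c q) = c * L q"
    and degree_p: "degree (p k) = k"
    and lead_coeff_p: "lead_coeff (p k) = 1"
    and orthogonal: "j \<noteq> k \<Longrightarrow> L (p j * p k) = 0"
    and norm_pos: "L (p k * p k) > 0"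
begin

definition sqnorm :: "nat \<Rightarrow> real" where
  "sqnorm k = L (p k * p k)"

definition recurrence_diag :: "nat \<Rightarrow> real" where
  "recurrence_diag k = L ([:0, 1:] * p k * p k) / sqnorm k"

definition anti_gauss :: "nat \<Rightarrow> real poly" where
  "anti_gauss n = Polynomial.smult 2 (p (Suc n)) + [:recurrence_diag n, -1:] * p n"

text \<open>The reproducing kernel of the modified orthonormal family, free of square roots.\<close>

definition kernel :: "nat \<Rightarrow> real \<Rightarrow> real \<Rightarrow> real" where
  "kernel n x y = (\<Sum>k\<le>n. poly (p k) x * poly (p k) y / modified_sqnorm sqnorm n k)"

lemma sqnorm_pos: "sqnorm k > 0"
  using norm_pos by (simp add: sqnorm_def)

lemma coeff_p_top: "poly.coeff (p k) k = 1"
  using lead_coeff_p[of k] by (simp add: degree_p)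

lemma p_0: "p 0 = 1"
  using degree_p[of 0] coeff_p_top[of 0] by (metis degree_0_id one_pCons)

lemma coeff_p_above: "i > k \<Longrightarrow> poly.coeff (p k) i = 0"
  by (simp add: coeff_eq_0 degree_p)

lemma L_diff: "L (q - r) = L q - L r"
  using L_add[of "q - r" r] by simp

text \<open>In this and the next lemma the degree bound is expressed by vanishing coefficients, so that
  the bound \<open>0\<close> means the zero polynomial and starts the induction.\<close>

lemma orthogonal_to_lower_degree:
  assumes "\<And>i. i \<ge> n \<Longrightarrow> poly.coeff q i = 0"
  shows "L (q * p n) = 0"
proof -
  have "m \<le> n \<Longrightarrow> (\<And>i. i \<ge> m \<Longrightarrow> poly.coeff q i = 0) \<Longrightarrow> L (q * p n) = 0" for m
  proof (induction m arbitrary: q)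
    case 0
    hence "q = 0" by (intro poly_eqI) simp
    thus ?case using L_smult[of 0 0] by simp
  next
    case (Suc m)
    define r where "r = q - Polynomial.smult (poly.coeff q m) (p m)"
    have "poly.coeff r i = 0" if "i \<ge> m" for i
      using that Suc.prems(2)[of i] coeff_p_above[of m i]
      by (cases "i = m") (auto simp: r_def coeff_p_top)
    hence "L (r * p n) = 0"
      using Suc.IH[of r] Suc.prems(1) by simp
    moreover have "q * p n = r * p n + Polynomial.smult (poly.coeff q m) (p m * p n)"
      by (simp add: r_def algebra_simps)
    ultimately show ?case
      using Suc.prems(1) by (simp add: L_add L_smult orthogonal)
  qed
  with assms show ?thesis by blast
qed

lemma eq_0_if_orthogonal:
  assumes "\<And>i. i \<ge> m \<Longrightarrow> poly.coeff q i = 0" "\<And>k. k < m \<Longrightarrow> L (q * p k) = 0"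
  shows "q = 0"
  using assms
proof (induction m)
  case 0
  thus ?case by (intro poly_eqI) simp
next
  case (Suc m)
  define c where "c = poly.coeff q m"
  have "L ((q - Polynomial.smult c (p m)) * p m) = 0"
    using Suc.prems(1) coeff_p_above coeff_p_top
    by (intro orthogonal_to_lower_degree) (metis c_def coeff_diff coeff_smult diff_self le_eq_less_or_eq
        mult.right_neutral mult_zero_right Suc_leI)
  hence "c * sqnorm m = 0"
    using Suc.prems(2)[of m] by (simp add: left_diff_distrib L_diff L_smult sqnorm_def)
  hence "poly.coeff q m = 0"
    using sqnorm_pos[of m] by (simp add: c_def)
  thus ?case
    using Suc.prems by (intro Suc.IH) (metis le_eq_less_or_eq Suc_leI, simp)
qed

text \<open>The difference of the two sides has degree at most \<open>k\<close>, as the leading terms cancel, and is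
  orthogonal to every \<open>p j\<close> with \<open>j \<le> k\<close>: since \<open>x p\<^sub>k\<close> paired with \<open>p\<^sub>j\<close> is \<open>p\<^sub>k\<close> paired with
  \<open>x p\<^sub>j\<close>, only \<open>j = k\<close> and \<open>j = k - 1\<close> contribute, and the coefficients are chosen to cancel
  these two. The conditional covers \<open>k = 0\<close>, where there is no predecessor.\<close>

lemma three_term_recurrence:
  "[:0, 1:] * p k = p (Suc k) + Polynomial.smult (recurrence_diag k) (p k)
     + Polynomial.smult (if k = 0 then 0 else sqnorm k / sqnorm (k - 1)) (p (k - 1))"
proof -
  define be where "be = (if k = 0 then 0 else sqnorm k / sqnorm (k - 1))"
  define r where "r = [:0, 1:] * p k - p (Suc k) - Polynomial.smult (recurrence_diag k) (p k)
     - Polynomial.smult be (p (k - 1))"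
  have "r = 0"
  proof (rule eq_0_if_orthogonal[of "Suc k"])
    fix i assume i: "i \<ge> Suc k"
    then obtain j where j: "i = Suc j" "j \<ge> k" by (cases i) auto
    show "poly.coeff r i = 0"
    proof (cases "j = k")
      case True
      thus ?thesis using j coeff_p_top[of k] coeff_p_top[of "Suc k"]
        by (simp add: r_def coeff_p_above)
    next
      case False
      thus ?thesis using j
        by (simp add: r_def coeff_p_above)
    qed
  next
    fix j assume j: "j < Suc k"
    have sym: "L ([:0, 1:] * p k * p j) = L (([:0, 1:] * p j) * p k)"
      by (simp add: mult_ac)
    have main: "L (r * p j) = L ([:0, 1:] * p k * p j) - L (p (Suc k) * p j)
        - recurrence_diag k * L (p k * p j) - be * L (p (k - 1) * p j)"
      by (simp only: r_def left_diff_distrib L_diff L_smult mult_smult_left)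
    have succ: "L (p (Suc k) * p j) = 0"
      using j by (intro orthogonal) simp
    consider "j = k" | "Suc j = k" | "Suc j < k" using j by linarith
    thus "L (r * p j) = 0"
    proof cases
      case 1
      have "be * L (p (k - 1) * p j) = 0"
        using 1 by (cases "k = 0") (auto simp: be_def intro: orthogonal)
      with main 1 succ sqnorm_pos[of k] show ?thesis
        by (simp add: recurrence_diag_def sqnorm_def)
    next
      case 2
      have "L (([:0, 1:] * p j - p k) * p k) = 0"
      proof (rule orthogonal_to_lower_degree)
        fix i assume i: "i \<ge> k"
        then obtain l where "i = Suc l" "l \<ge> j" using 2 by (cases i) auto
        with 2 show "poly.coeff ([:0, 1:] * p j - p k) i = 0"
          using coeff_p_top[of k] coeff_p_top[of j]
          by (cases "l = j") (auto simp: coeff_p_above)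
      qed
      hence "L (([:0, 1:] * p j) * p k) = sqnorm k"
        by (simp only: left_diff_distrib L_diff sqnorm_def)
      moreover have "L (p k * p j) = 0"
        using 2 by (intro orthogonal) simp
      moreover have "be * L (p (k - 1) * p j) = sqnorm k"
        using 2 sqnorm_pos[of j] by (auto simp: be_def sqnorm_def)
      ultimately show ?thesis
        using main sym succ by simp
    next
      case 3
      have "L (([:0, 1:] * p j) * p k) = 0"
      proof (rule orthogonal_to_lower_degree)
        fix i assume i: "i \<ge> k"
        then obtain l where "i = Suc l" "l > j" using 3 by (cases i) auto
        thus "poly.coeff ([:0, 1:] * p j) i = 0"
          by (simp add: coeff_p_above)
      qed
      moreover have "L (p k * p j) = 0" "L (p (k - 1) * p j) = 0"
        using 3 by (auto intro: orthogonal)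
      ultimately show ?thesis
        using main sym succ by simp
    qed
  qed
  thus ?thesis
    by (simp add: r_def be_def algebra_simps)
qed

section \<open>Zeros of the anti-Gauss polynomial\<close>

lemma anti_gauss_monic: "degree (anti_gauss n) = Suc n" "lead_coeff (anti_gauss n) = 1"
proof -
  have top: "poly.coeff (anti_gauss n) (Suc n) = 1"
    using coeff_p_top[of n] coeff_p_top[of "Suc n"] by (simp add: anti_gauss_def coeff_p_above)
  have "poly.coeff (anti_gauss n) i = 0" if "i > Suc n" for i
    using that by (cases i) (auto simp: anti_gauss_def coeff_p_above)
  hence "degree (anti_gauss n) \<le> Suc n"
    by (intro degree_le) auto
  moreover have "degree (anti_gauss n) \<ge> Suc n"
    using top by (intro le_degree) simp
  ultimately show "degree (anti_gauss n) = Suc n" by simp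
  with top show "lead_coeff (anti_gauss n) = 1" by simp
qed

lemma kernel_diag_pos: "kernel n y y > 0"
proof -
  have "0 < poly (p 0) y * poly (p 0) y / modified_sqnorm sqnorm n 0"
    using sqnorm_pos[of 0] by (simp add: modified_sqnorm_def p_0)
  also have "\<dots> \<le> kernel n y y"
    unfolding kernel_def using sqnorm_pos
    by (intro member_le_sum) (auto simp: modified_sqnorm_def less_imp_le)
  finally show ?thesis .
qed

lemma kernel_christoffel_darboux:
  "(x - y) * kernel n x y =
     (poly (anti_gauss n) x * poly (p n) y - poly (anti_gauss n) y * poly (p n) x) / (2 * sqnorm n)"
proof -
  have rec: "z * poly (p k) z = poly (p (Suc k)) z + recurrence_diag k * poly (p k) z
     + (if k = 0 then 0 else sqnorm k / sqnorm (k - 1)) * poly (p (k - 1)) z" for z k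
    using arg_cong[OF three_term_recurrence, of "\<lambda>q. poly q z" k] by simp
  have "(x - y) * kernel n x y =
      ((2 * poly (p (Suc n)) x + (recurrence_diag n - x) * poly (p n) x) * poly (p n) y -
       (2 * poly (p (Suc n)) y + (recurrence_diag n - y) * poly (p n) y) * poly (p n) x) / (2 * sqnorm n)"
    unfolding kernel_def
    by (rule anti_gauss_christoffel_darboux[OF _ rec rec])
      (use sqnorm_pos in \<open>simp add: less_imp_neq[symmetric]\<close>)
  thus ?thesis by (simp only: anti_gauss_def) (simp add: algebra_simps)
qed

text \<open>The polynomial has real coefficients, so it also vanishes at the conjugate of \<open>z\<close>. If the two
  points differed, the Christoffel-Darboux identity would make the sum of \<open>|p\<^sub>k(z)|\<^sup>2\<close> with positive
  weights vanish, but \<open>p\<^sub>0 = 1\<close> contributes a positive term.\<close>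

lemma anti_gauss_complex_root_real:
  fixes z :: complex
  assumes "poly (map_poly of_real (anti_gauss n)) z = 0"
  shows "z \<in> \<real>"
proof (rule ccontr)
  assume "z \<notin> \<real>"
  define u where "u = (\<lambda>k t. poly (map_poly complex_of_real (p k)) t)"
  have cnj: "u k (cnj z) = cnj (u k z)" for k
    unfolding u_def by (rule poly_cnj_real[symmetric]) (simp add: coeff_map_poly)
  have rec: "t * u k t = u (Suc k) t + of_real (recurrence_diag k) * u k t
     + (if k = 0 then 0 else of_real (sqnorm k) / of_real (sqnorm (k - 1))) * u (k - 1) t" for t k
    using arg_cong[OF three_term_recurrence, of "\<lambda>q. poly (map_poly complex_of_real q) t" k]
    by (cases "k = 0") (simp_all add: u_def of_real_hom.map_poly_hom_add
      of_real_hom.map_poly_hom_smult of_real_hom.map_poly_pCons_hom)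
  have anti_gauss: "poly (map_poly complex_of_real (anti_gauss n)) t =
      2 * u (Suc n) t + (of_real (recurrence_diag n) - t) * u n t" for t
    \<comment> \<open>The term \<open>- x * p n\<close> appears as a negated polynomial, treated as a multiple by \<open>-1\<close>.\<close>
    using map_poly_smult[of complex_of_real "-1" "p n"]
    by (simp add: anti_gauss_def u_def of_real_hom.map_poly_hom_add
      of_real_hom.map_poly_hom_smult of_real_hom.map_poly_pCons_hom algebra_simps)
  have "poly (map_poly complex_of_real (anti_gauss n)) (cnj z)
      = cnj (poly (map_poly complex_of_real (anti_gauss n)) z)"
    by (rule poly_cnj_real[symmetric]) (simp add: coeff_map_poly)
  hence root: "2 * u (Suc n) z + (of_real (recurrence_diag n) - z) * u n z = 0"
    "2 * u (Suc n) (cnj z) + (of_real (recurrence_diag n) - cnj z) * u n (cnj z) = 0"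
    using assms anti_gauss[of z] anti_gauss[of "cnj z"] by auto
  have "(z - cnj z) * (\<Sum>k\<le>n. u k z * u k (cnj z) / modified_sqnorm (\<lambda>k. of_real (sqnorm k)) n k) = 0"
    by (subst anti_gauss_christoffel_darboux[OF _ rec rec])
      (use sqnorm_pos root in \<open>auto simp: less_imp_neq[symmetric]\<close>)
  moreover have "z \<noteq> cnj z"
    using \<open>z \<notin> \<real>\<close> by (metis Reals_cnj_iff)
  ultimately have 0: "(\<Sum>k\<le>n. u k z * u k (cnj z) / modified_sqnorm (\<lambda>k. of_real (sqnorm k)) n k) = 0"
    by simp
  have "u k z * u k (cnj z) / modified_sqnorm (\<lambda>k. of_real (sqnorm k)) n k =
      of_real ((cmod (u k z))\<^sup>2 / modified_sqnorm sqnorm n k)" for k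
    by (simp add: cnj modified_sqnorm_def flip: complex_norm_square)
  with 0 have "complex_of_real (\<Sum>k\<le>n. (cmod (u k z))\<^sup>2 / modified_sqnorm sqnorm n k) = 0"
    by (simp only: of_real_sum)
  hence 0: "(\<Sum>k\<le>n. (cmod (u k z))\<^sup>2 / modified_sqnorm sqnorm n k) = 0"
    by (simp only: of_real_eq_0_iff)
  have "u 0 z = 1"
    by (simp add: u_def p_0)
  hence "0 < (cmod (u 0 z))\<^sup>2 / modified_sqnorm sqnorm n 0"
    using sqnorm_pos[of 0] by (simp add: modified_sqnorm_def)
  also have "\<dots> \<le> (\<Sum>k\<le>n. (cmod (u k z))\<^sup>2 / modified_sqnorm sqnorm n k)"
    using sqnorm_pos by (intro member_le_sum) (auto simp: modified_sqnorm_def less_imp_le)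
  finally show False using 0 by simp
qed

text \<open>A slice of the kernel as a formal polynomial, which allows differentiation at the node and
  cancellation of the factor \<open>x - y\<close>.\<close>

definition kernel_poly :: "nat \<Rightarrow> real \<Rightarrow> real poly" where
  "kernel_poly n y = (\<Sum>k\<le>n. Polynomial.smult (poly (p k) y / modified_sqnorm sqnorm n k) (p k))"

lemma poly_kernel_poly: "poly (kernel_poly n y) x = kernel n x y"
  by (simp add: kernel_poly_def kernel_def poly_sum mult_ac)

lemma kernel_poly_at_root:
  assumes "poly (anti_gauss n) y = 0"
  shows "[:-y, 1:] * kernel_poly n y
      = Polynomial.smult (poly (p n) y / (2 * sqnorm n)) (anti_gauss n)"
proof (rule poly_ext)
  fix x
  show "poly ([:-y, 1:] * kernel_poly n y) x
      = poly (Polynomial.smult (poly (p n) y / (2 * sqnorm n)) (anti_gauss n)) x"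
    using kernel_christoffel_darboux[of x y n] assms by (simp add: poly_kernel_poly algebra_simps)
qed

text \<open>Differentiating \<open>(x - y) K(x,y)\<close> at \<open>x = y\<close> leaves \<open>K(y,y)\<close>. With positivity of the diagonal,
  this identifies the Christoffel numbers and shows that the zeros are simple.\<close>

lemma kernel_diag:
  assumes "poly (anti_gauss n) y = 0"
  shows "kernel n y y = poly (p n) y * poly (pderiv (anti_gauss n)) y / (2 * sqnorm n)"
proof -
  have "poly (pderiv ([:-y, 1:] * kernel_poly n y)) y = kernel n y y"
    by (simp add: pderiv_mult pderiv_pCons poly_kernel_poly del: mult_pCons_left)
  thus ?thesis
    by (simp only: kernel_poly_at_root[OF assms]) (simp add: pderiv_smult)
qed

text \<open>Over the complex numbers a polynomial of degree \<open>n + 1\<close> without multiple zeros has \<open>n + 1\<close>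
  distinct ones, and here all of them are real.\<close>

lemma card_anti_gauss_roots: "card {x. poly (anti_gauss n) x = 0} = Suc n"
proof -
  let ?Q = "map_poly complex_of_real (anti_gauss n)"
  have of_real: "poly ?Q (of_real x) = of_real (poly (anti_gauss n) x)" for x
    by (rule of_real_hom.poly_map_poly)
  have roots: "{z. poly ?Q z = 0} = of_real ` {x. poly (anti_gauss n) x = 0}"
  proof (intro equalityI subsetI)
    fix z assume z: "z \<in> {z. poly ?Q z = 0}"
    then obtain x where "z = of_real x"
      using anti_gauss_complex_root_real[of n z] by (auto elim: Reals_cases)
    with z show "z \<in> of_real ` {x. poly (anti_gauss n) x = 0}"
      using of_real[of x] by auto
  qed (auto simp: of_real)
  have "rsquarefree ?Q"
    unfolding rsquarefree_roots
  proof (intro allI notI)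
    fix z assume z: "poly ?Q z = 0 \<and> poly (pderiv ?Q) z = 0"
    then obtain x where x: "z = of_real x" "poly (anti_gauss n) x = 0"
      using roots by blast
    have "pderiv ?Q = map_poly of_real (pderiv (anti_gauss n))"
      by (intro poly_eqI) (simp add: coeff_pderiv coeff_map_poly)
    hence "poly (pderiv (anti_gauss n)) x = 0"
      using z x of_real_hom.poly_map_poly[where ?'a = complex, of "pderiv (anti_gauss n)" x] by simp
    thus False
      using kernel_diag[OF x(2)] kernel_diag_pos[of n x] by simp
  qed
  from complex_poly_decompose_rsquarefree[OF this]
  have "degree ?Q = degree (\<Prod>z | poly ?Q z = 0. [:-z, 1:])"
    using anti_gauss_monic[of n]
    by (metis degree_smult_eq leading_coeff_0_iff degree_0 of_real_hom.degree_map_poly_hom Zero_not_Suc)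
  also have "\<dots> = card {z. poly ?Q z = 0}"
    by (subst degree_prod_sum_eq) auto
  also have "\<dots> = card {x. poly (anti_gauss n) x = 0}"
    unfolding roots by (rule card_image) (simp add: inj_on_def)
  finally show ?thesis
    using anti_gauss_monic[of n] by (simp add: of_real_hom.degree_map_poly_hom)
qed

section \<open>Fundamental Lagrange polynomials as kernel slices\<close>

text \<open>The anti-Gauss polynomial and the product of the \<open>x - xt j\<close> are monic of degree \<open>n + 1\<close> and
  vanish at the same \<open>n + 1\<close> points, so they agree. Cancelling \<open>x - xt k\<close> in the
  Christoffel-Darboux identity then shows that the slice at \<open>xt k\<close> is proportional to the numerator
  of the fundamental polynomial; evaluation at \<open>xt k\<close> determines the factor.\<close>

lemma lagrange_basis_eq_kernel:
  assumes zeros: "xt ` {1..n+1} = {x. poly (anti_gauss n) x = 0}" and k: "k \<in> {1..n+1}"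
  shows "lagrange_basis n xt k x = kernel n x (xt k) / kernel n (xt k) (xt k)"
proof -
  let ?y = "xt k" and ?A = "{1..n+1} - {k}"
  have root: "poly (anti_gauss n) (xt j) = 0" if "j \<in> {1..n+1}" for j
    using zeros that by blast
  have "anti_gauss n = (\<Prod>j\<in>{1..n+1}. [:- xt j, 1:])"
  proof (rule poly_eqI_degree_lead_coeff[where n = "Suc n" and A = "xt ` {1..n+1}"])
    show "card (xt ` {1..n+1}) \<ge> Suc n"
      by (simp only: zeros card_anti_gauss_roots)
    have deg: "degree (\<Prod>j\<in>{1..n+1}. [:- xt j, 1:]) = Suc n"
      by (subst degree_prod_sum_eq) auto
    thus "degree (\<Prod>j\<in>{1..n+1}. [:- xt j, 1:]) \<le> Suc n" by simp
    show "degree (anti_gauss n) \<le> Suc n"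
      by (simp add: anti_gauss_monic)
    have "lead_coeff (\<Prod>j\<in>{1..n+1}. [:- xt j, 1:]) = 1"
      by (simp only: lead_coeff_prod) simp
    thus "poly.coeff (anti_gauss n) (Suc n) = poly.coeff (\<Prod>j\<in>{1..n+1}. [:- xt j, 1:]) (Suc n)"
      using anti_gauss_monic[of n] unfolding deg by simp
    fix z assume "z \<in> xt ` {1..n+1}"
    then obtain i where i: "i \<in> {1..n+1}" "z = xt i" by blast
    hence "(\<Prod>j\<in>{1..n+1}. poly [:- xt j, 1:] z) = 0"
      by (intro prod_zero bexI[of _ i]) auto
    thus "poly (anti_gauss n) z = poly (\<Prod>j\<in>{1..n+1}. [:- xt j, 1:]) z"
      using root i by (simp only: poly_prod)
  qed
  also have "\<dots> = [:- ?y, 1:] * (\<Prod>j\<in>?A. [:- xt j, 1:])"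
    using k by (subst prod.remove[of _ k]) auto
  finally have "[:- ?y, 1:] * kernel_poly n ?y
      = [:- ?y, 1:] * Polynomial.smult (poly (p n) ?y / (2 * sqnorm n)) (\<Prod>j\<in>?A. [:- xt j, 1:])"
    using kernel_poly_at_root[OF root[OF k]] by (simp only: mult_smult_right)
  hence "kernel_poly n ?y = Polynomial.smult (poly (p n) ?y / (2 * sqnorm n)) (\<Prod>j\<in>?A. [:- xt j, 1:])"
    by (simp only: mult_cancel_left) simp
  hence "kernel n z ?y = poly (p n) ?y / (2 * sqnorm n) * (\<Prod>j\<in>?A. z - xt j)" for z
    by (simp add: poly_prod flip: poly_kernel_poly)
  moreover have "poly (p n) ?y / (2 * sqnorm n) \<noteq> 0"
    using kernel_diag[OF root[OF k]] kernel_diag_pos[of n ?y] by auto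
  ultimately show ?thesis
    by (simp add: lagrange_basis_def prod_dividef)
qed

end

section \<open>The functional of a weight, and the expansion\<close>

lemma set_integrable_poly_weight:
  assumes "weight_on a b w"
  shows "set_integrable lebesgue {a..b} (\<lambda>x. poly q x * w x)"
proof -
  \<comment> \<open>The power of \<open>x\<close> accumulates the factors split off from \<open>q\<close> by Horner's rule.\<close>
  have "set_integrable lebesgue {a..b} (\<lambda>x. x ^ m * poly q x * w x)" for m
  proof (induction q arbitrary: m)
    case 0
    show ?case by (simp add: set_integrable_def)
  next
    case (pCons c q)
    have "set_integrable lebesgue {a..b} (\<lambda>x. c * (x ^ m * w x) + x ^ Suc m * poly q x * w x)"
      using assms pCons.IH[of "Suc m"]
      by (intro set_integral_add set_integrable_mult_right) (auto simp: weight_on_def)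
    also have "(\<lambda>x. c * (x ^ m * w x) + x ^ Suc m * poly q x * w x) = (\<lambda>x. x ^ m * poly (pCons c q) x * w x)"
      by (auto simp: algebra_simps)
    finally show ?case .
  qed
  from this[of 0] show ?thesis by simp
qed

text \<open>If the integral vanished, \<open>q\<^sup>2 w\<close> would be zero almost everywhere, and so would \<open>w\<close>, as \<open>q\<close> has
  only finitely many zeros; but \<open>w\<close> has positive integral.\<close>

lemma integral_square_poly_pos:
  assumes w: "weight_on a b w" and q: "q \<noteq> 0"
  shows "(LINT x:{a..b}|lebesgue. poly (q * q) x * w x) > 0"
proof -
  let ?f = "\<lambda>x. indicator {a..b} x *\<^sub>R (poly (q * q) x * w x)"
  have int: "integrable lebesgue ?f"
    using set_integrable_poly_weight[OF w, of "q * q"] by (simp add: set_integrable_def)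
  have nonneg: "?f x \<ge> 0" for x
    using w by (auto simp: weight_on_def indicator_def)
  have "integral\<^sup>L lebesgue ?f \<noteq> 0"
  proof
    assume "integral\<^sup>L lebesgue ?f = 0"
    hence "AE x in lebesgue. ?f x = 0"
      using integral_nonneg_eq_0_iff_AE[OF int] nonneg by simp
    moreover have "AE x in lebesgue. x \<notin> {x. poly q x = 0}"
      using poly_roots_finite[OF q]
      by (intro AE_not_in) (auto intro: negligible_finite simp: negligible_iff_null_sets[symmetric])
    ultimately have "AE x in lebesgue. indicator {a..b} x *\<^sub>R w x = 0"
      by eventually_elim auto
    hence "(LINT x:{a..b}|lebesgue. w x) = 0"
      unfolding set_lebesgue_integral_def by (rule integral_eq_zero_AE)
    with w show False by (simp add: weight_on_def)
  qed
  moreover have "integral\<^sup>L lebesgue ?f \<ge> 0"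
    using nonneg by (intro integral_nonneg_AE) simp
  ultimately show ?thesis
    by (simp add: set_lebesgue_integral_def)
qed

lemma orthogonal_polys_weight:
  assumes w: "weight_on a b w" and p: "monic_orthogonal_polys a b w p"
  shows "orthogonal_polys (\<lambda>q. LINT x:{a..b}|lebesgue. poly q x * w x) p"
proof
  fix q r :: "real poly" and c :: real and j k :: nat
  show "(LINT x:{a..b}|lebesgue. poly (q + r) x * w x) =
      (LINT x:{a..b}|lebesgue. poly q x * w x) + (LINT x:{a..b}|lebesgue. poly r x * w x)"
    by (simp add: distrib_right set_integrable_poly_weight[OF w])
  show "(LINT x:{a..b}|lebesgue. poly (Polynomial.smult c q) x * w x)
      = c * (LINT x:{a..b}|lebesgue. poly q x * w x)"
    by (simp add: mult.assoc)
  show "degree (p k) = k" and lead: "lead_coeff (p k) = 1"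
    using p unfolding monic_orthogonal_polys_def by blast+
  show "(LINT x:{a..b}|lebesgue. poly (p j * p k) x * w x) = 0" if "j \<noteq> k"
    using p that by (simp add: monic_orthogonal_polys_def w_inner_def)
  show "0 < (LINT x:{a..b}|lebesgue. poly (p k * p k) x * w x)"
    using lead by (intro integral_square_poly_pos[OF w]) auto
qed

theorem theorem4p2:
  fixes a b :: real and w f :: "real \<Rightarrow> real" and p :: "nat \<Rightarrow> real poly"
    and n :: nat and xt :: "nat \<Rightarrow> real"
  assumes "weight_on a b w"
    and "monic_orthogonal_polys a b w p"
    and "enumerates_anti_gauss_zeros a b w p n xt"
    and "\<forall>k\<in>{1..n+1}. xt k \<in> {a..b}"
    and "continuous_on {a..b} f"
  shows "(\<forall>x. anti_gauss_lagrange n xt f x =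
            (\<Sum>j=0..n. expansion_coeff a b w p n xt f j * modified_orthonormal a b w p n j x)) \<and>
         Matrix.vec (n + 1) (expansion_coeff a b w p n xt f) =
           (transpose_mat (Q_matrix a b w p n xt) * christoffel_matrix_sqrt a b w p n xt)
             *\<^sub>v sample_vec n xt f"
proof -
  interpret orthogonal_polys "\<lambda>q. LINT x:{a..b}|lebesgue. poly q x * w x" p
    by (rule orthogonal_polys_weight[OF assms(1,2)])
  let ?lam = "anti_gauss_christoffel a b w p n xt" and ?phi = "modified_orthonormal a b w p n"
  have sq_norm: "sq_norm a b w p k = sqnorm k" for k
    by (simp add: sq_norm_def w_inner_def sqnorm_def)
  have anti_gauss: "anti_gauss_poly a b w p n = anti_gauss n"
    by (simp add: anti_gauss_poly_def anti_gauss_def recurrence_coeff_def recurrence_diag_def w_inner_def sqnorm_def mult.assoc)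
  have zeros: "xt ` {1..n+1} = {x. poly (anti_gauss n) x = 0}"
    using assms(3) by (simp add: enumerates_anti_gauss_zeros_def anti_gauss)
  have lam: "?lam k = 1 / kernel n (xt k) (xt k)" if "k \<in> {1..n+1}" for k
  proof -
    have "poly (anti_gauss n) (xt k) = 0"
      using zeros that by blast
    thus ?thesis
      by (simp add: anti_gauss_christoffel_def sq_norm anti_gauss kernel_diag)
  qed
  have lam_pos: "?lam k > 0" if "k \<in> {1..n+1}" for k
    using lam[OF that] kernel_diag_pos[of n "xt k"] by simp
  have "?phi k x * ?phi k y = poly (p k) x * poly (p k) y / modified_sqnorm sqnorm n k" if "k \<le> n" for k x y
    using that sqnorm_pos[of k]
    by (auto simp: modified_orthonormal_def orthonormal_poly_def sq_norm modified_sqnorm_def field_simps)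
  hence kernel: "(\<Sum>j=0..n. ?phi j x * ?phi j y) = kernel n x y" for x y
    by (simp add: kernel_def atLeast0AtMost)
  have "anti_gauss_lagrange n xt f x = (\<Sum>j=0..n. expansion_coeff a b w p n xt f j * ?phi j x)" for x
  proof -
    have "anti_gauss_lagrange n xt f x = (\<Sum>k=1..n+1. ?lam k * f (xt k) * kernel n x (xt k))"
      unfolding anti_gauss_lagrange_def
      by (intro sum.cong refl) (simp add: lam lagrange_basis_eq_kernel[OF zeros])
    also have "\<dots> = (\<Sum>k=1..n+1. \<Sum>j=0..n. ?lam k * f (xt k) * ?phi j (xt k) * ?phi j x)"
      by (intro sum.cong refl, simp only: kernel[symmetric] sum_distrib_left) (simp only: mult_ac)
    also have "\<dots> = (\<Sum>j=0..n. expansion_coeff a b w p n xt f j * ?phi j x)"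
      by (subst sum.swap) (simp only: expansion_coeff_def sum_distrib_right)
    finally show ?thesis .
  qed
  moreover have "Matrix.vec (n + 1) (expansion_coeff a b w p n xt f) =
      (transpose_mat (Q_matrix a b w p n xt) * christoffel_matrix_sqrt a b w p n xt) *\<^sub>v sample_vec n xt f"
  proof (rule eq_vecI)
    have diag: "christoffel_matrix_sqrt a b w p n xt = mat_diag (n + 1) (\<lambda>i. sqrt (?lam (i + 1)))"
      by (rule eq_matI) (auto simp: christoffel_matrix_sqrt_def christoffel_matrix_def mat_diag_def)
    \<comment> \<open>The two square roots of a Christoffel number multiply to that number because it is
      positive.\<close>
    have prod: "transpose_mat (Q_matrix a b w p n xt) * christoffel_matrix_sqrt a b w p n xt =
        Matrix.mat (n + 1) (n + 1) (\<lambda>(j, i). ?lam (i + 1) * ?phi j (xt (i + 1)))"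
      unfolding diag
      by (subst mat_diag_mult_right[of _ "n + 1"])
        (auto simp: Q_matrix_def less_imp_le[OF lam_pos] intro!: eq_matI)
    fix j assume "j < dim_vec ((transpose_mat (Q_matrix a b w p n xt) * christoffel_matrix_sqrt a b w p n xt)
      *\<^sub>v sample_vec n xt f)"
    hence j: "j < n + 1"
      by (simp add: Q_matrix_def)
    have "expansion_coeff a b w p n xt f j = (\<Sum>i<n+1. ?lam (i + 1) * ?phi j (xt (i + 1)) * f (xt (i + 1)))"
      unfolding expansion_coeff_def
      by (rule sum.reindex_bij_witness[of _ "\<lambda>i. i + 1" "\<lambda>k. k - 1"]) auto
    thus "vec_index (Matrix.vec (n + 1) (expansion_coeff a b w p n xt f)) j =
        vec_index ((transpose_mat (Q_matrix a b w p n xt) * christoffel_matrix_sqrt a b w p n xt)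
          *\<^sub>v sample_vec n xt f) j"
      using j unfolding prod
      by (simp add: sample_vec_def scalar_prod_def atLeast0LessThan)
  qed (simp add: Q_matrix_def)
  ultimately show ?thesis by blast
qed

end
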